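(* wBIL is not finitely equivalential: there is no finite set $\Delta(x,y)$ of formulas in the two variables $x,y$ satisfying (R) $\vdash_w\Delta(x,x)$; (MP') $x,\Delta(x,y)\vdash_w y$; and (Re) for every connective $\lambda\in\{\top,\bot,\wedge,\vee,\to,\prec\}$ of arity $n$, $\Delta(x_1,y_1),\dots,\Delta(x_n,y_n)\vdash_w\Delta(\lambda x_1\dots x_n,\lambda y_1\dots y_n)$.
   Context: Fix a countably infinite set $\mathrm{Prop}$ of propositional variables. Bi-intuitionistic formulas are generated by $\phi ::= p \mid \bot \mid \top \mid \phi\wedge\phi \mid \phi\vee\phi \mid \phi\to\phi \mid \phi\prec\phi$ with $p\in\mathrm{Prop}$ ($\prec$ is exclusion). Abbreviations: $\neg\phi := \phi\to\bot$, ${\sim}\phi := \top\prec\phi$. An axiom is any instance of: (A1) $\phi\to(\psi\to\phi)$; (A2) $(\phi\to(\psi\to\chi))\to((\phi\to\psi)\to(\phi\to\chi))$; (A3) $\phi\to(\phi\vee\psi)$; (A4) $\psi\to(\phi\vee\psi)$; (A5) $(\phi\to\chi)\to((\psi\to\chi)\to((\phi\vee\psi)\to\chi))$; (A6) $(\phi\wedge\psi)\to\phi$; (A7) $(\phi\wedge\psi)\to\psi$; (A8) $(\chi\to\phi)\to((\chi\to\psi)\to(\chi\to(\phi\wedge\psi)))$; (A9) $\bot\to\phi$; (A10) $\phi\to\top$; (A11) $\phi\to(\psi\vee(\phi\prec\psi))$; (A12) $(\phi\prec\psi)\to{\sim}(\phi\to\psi)$; (A13) $((\phi\prec\psi)\prec\chi)\to(\phi\prec(\psi\vee\chi))$;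 (A14) $\neg(\phi\prec\psi)\to(\phi\to\psi)$. wBIL is the relation $\Gamma\vdash_w\phi$ holding iff $\Gamma\vdash\phi$ is derivable with: (Ax) $\Gamma\vdash\phi$ for any axiom $\phi$; (El) $\Gamma\vdash\phi$ if $\phi\in\Gamma$; (MP) from $\Gamma\vdash\phi$ and $\Gamma\vdash\phi\to\psi$ infer $\Gamma\vdash\psi$; (wDN) from $\emptyset\vdash\phi$ infer $\Gamma\vdash\neg{\sim}\phi$. $\Delta(\phi,\psi)$ denotes substitution of $\phi,\psi$ for $x,y$; a set on the right of $\vdash_w$ means each member is derivable. *)

theory Defs
  imports "HOL-Library.Countable_Set"
begin

datatype 'p fm =
    Var 'p
  | Bot ("\<^bold>\<bottom>")
  | Top ("\<^bold>\<top>")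
  | And "'p fm" "'p fm" (infixr "\<^bold>\<and>" 55)
  | Or "'p fm" "'p fm" (infixr "\<^bold>\<or>" 54)
  | Imp "'p fm" "'p fm" (infixr "\<^bold>\<rightarrow>" 52)
  | Excl "'p fm" "'p fm" (infix "\<^bold>\<prec>" 53)

abbreviation Neg :: "'p fm \<Rightarrow> 'p fm" ("\<^bold>\<not> _" [60] 60)
  where "\<^bold>\<not> \<phi> \<equiv> \<phi> \<^bold>\<rightarrow> \<^bold>\<bottom>"

abbreviation WNeg :: "'p fm \<Rightarrow> 'p fm" ("\<^bold>\<sim> _" [60] 60)
  where "\<^bold>\<sim> \<phi> \<equiv> \<^bold>\<top> \<^bold>\<prec> \<phi>"

inductive bil_axiom :: "'p fm \<Rightarrow> bool" where
  A1: "bil_axiom (\<phi> \<^bold>\<rightarrow> (\<psi> \<^bold>\<rightarrow> \<phi>))"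
| A2: "bil_axiom ((\<phi> \<^bold>\<rightarrow> (\<psi> \<^bold>\<rightarrow> \<chi>)) \<^bold>\<rightarrow> ((\<phi> \<^bold>\<rightarrow> \<psi>) \<^bold>\<rightarrow> (\<phi> \<^bold>\<rightarrow> \<chi>)))"
| A3: "bil_axiom (\<phi> \<^bold>\<rightarrow> (\<phi> \<^bold>\<or> \<psi>))"
| A4: "bil_axiom (\<psi> \<^bold>\<rightarrow> (\<phi> \<^bold>\<or> \<psi>))"
| A5: "bil_axiom ((\<phi> \<^bold>\<rightarrow> \<chi>) \<^bold>\<rightarrow> ((\<psi> \<^bold>\<rightarrow> \<chi>) \<^bold>\<rightarrow> ((\<phi> \<^bold>\<or> \<psi>) \<^bold>\<rightarrow> \<chi>)))"
| A6: "bil_axiom ((\<phi> \<^bold>\<and> \<psi>) \<^bold>\<rightarrow> \<phi>)"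
| A7: "bil_axiom ((\<phi> \<^bold>\<and> \<psi>) \<^bold>\<rightarrow> \<psi>)"
| A8: "bil_axiom ((\<chi> \<^bold>\<rightarrow> \<phi>) \<^bold>\<rightarrow> ((\<chi> \<^bold>\<rightarrow> \<psi>) \<^bold>\<rightarrow> (\<chi> \<^bold>\<rightarrow> (\<phi> \<^bold>\<and> \<psi>))))"
| A9: "bil_axiom (\<^bold>\<bottom> \<^bold>\<rightarrow> \<phi>)"
| A10: "bil_axiom (\<phi> \<^bold>\<rightarrow> \<^bold>\<top>)"
| A11: "bil_axiom (\<phi> \<^bold>\<rightarrow> (\<psi> \<^bold>\<or> (\<phi> \<^bold>\<prec> \<psi>)))"
| A12: "bil_axiom ((\<phi> \<^bold>\<prec> \<psi>) \<^bold>\<rightarrow> \<^bold>\<sim> (\<phi> \<^bold>\<rightarrow> \<psi>))"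
| A13: "bil_axiom (((\<phi> \<^bold>\<prec> \<psi>) \<^bold>\<prec> \<chi>) \<^bold>\<rightarrow> (\<phi> \<^bold>\<prec> (\<psi> \<^bold>\<or> \<chi>)))"
| A14: "bil_axiom (\<^bold>\<not> (\<phi> \<^bold>\<prec> \<psi>) \<^bold>\<rightarrow> (\<phi> \<^bold>\<rightarrow> \<psi>))"

inductive wBIL :: "'p fm set \<Rightarrow> 'p fm \<Rightarrow> bool" (infix "\<turnstile>\<^sub>w" 50) where
  Ax: "bil_axiom \<phi> \<Longrightarrow> \<Gamma> \<turnstile>\<^sub>w \<phi>"
| El: "\<phi> \<in> \<Gamma> \<Longrightarrow> \<Gamma> \<turnstile>\<^sub>w \<phi>"
| MP: "\<Gamma> \<turnstile>\<^sub>w \<phi> \<Longrightarrow> \<Gamma> \<turnstile>\<^sub>w \<phi> \<^bold>\<rightarrow> \<psi> \<Longrightarrow> \<Gamma> \<turnstile>\<^sub>w \<psi>"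
| wDN: "{} \<turnstile>\<^sub>w \<phi> \<Longrightarrow> \<Gamma> \<turnstile>\<^sub>w \<^bold>\<not> (\<^bold>\<sim> \<phi>)"

primrec subst :: "('p \<Rightarrow> 'p fm) \<Rightarrow> 'p fm \<Rightarrow> 'p fm" where
  "subst \<sigma> (Var p) = \<sigma> p"
| "subst \<sigma> \<^bold>\<bottom> = \<^bold>\<bottom>"
| "subst \<sigma> \<^bold>\<top> = \<^bold>\<top>"
| "subst \<sigma> (\<phi> \<^bold>\<and> \<psi>) = subst \<sigma> \<phi> \<^bold>\<and> subst \<sigma> \<psi>"
| "subst \<sigma> (\<phi> \<^bold>\<or> \<psi>) = subst \<sigma> \<phi> \<^bold>\<or> subst \<sigma> \<psi>"
| "subst \<sigma> (\<phi> \<^bold>\<rightarrow> \<psi>) = subst \<sigma> \<phi> \<^bold>\<rightarrow> subst \<sigma> \<psi>"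
| "subst \<sigma> (\<phi> \<^bold>\<prec> \<psi>) = subst \<sigma> \<phi> \<^bold>\<prec> subst \<sigma> \<psi>"

definition inst2 :: "'p \<Rightarrow> 'p \<Rightarrow> 'p fm set \<Rightarrow> 'p fm \<Rightarrow> 'p fm \<Rightarrow> 'p fm set" where
  "inst2 x y \<Delta> \<phi> \<psi> = subst (Var(x := \<phi>, y := \<psi>)) ` \<Delta>"

definition derives_all :: "('p fm set \<Rightarrow> 'p fm \<Rightarrow> bool) \<Rightarrow> 'p fm set \<Rightarrow> 'p fm set \<Rightarrow> bool" where
  "derives_all L \<Gamma> \<Theta> \<longleftrightarrow> (\<forall>\<theta>\<in>\<Theta>. L \<Gamma> \<theta>)"

text \<open>
  \<open>set_fm \<phi>\<close> is the set of variables occurring in \<open>\<phi>\<close>. The condition (Re) is stated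
  separately for the nullary and the binary connectives; the variables
  \<open>x\<^sub>1, y\<^sub>1, x\<^sub>2, y\<^sub>2\<close> in it are pairwise distinct, but may coincide with \<open>x\<close> or \<open>y\<close>.
\<close>

definition equivalence_formulas ::
  "('p fm set \<Rightarrow> 'p fm \<Rightarrow> bool) \<Rightarrow> 'p \<Rightarrow> 'p \<Rightarrow> 'p fm set \<Rightarrow> bool" where
  "equivalence_formulas L x y \<Delta> \<longleftrightarrow>
     x \<noteq> y \<and> (\<forall>\<delta>\<in>\<Delta>. set_fm \<delta> \<subseteq> {x, y}) \<and>
     derives_all L {} (inst2 x y \<Delta> (Var x) (Var x)) \<and>
     L (insert (Var x) (inst2 x y \<Delta> (Var x) (Var y))) (Var y) \<and>
     (\<forall>c\<in>{Top, Bot}. derives_all L {} (inst2 x y \<Delta> c c)) \<and>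
     (\<forall>c\<in>{And, Or, Imp, Excl}. \<forall>x\<^sub>1 y\<^sub>1 x\<^sub>2 y\<^sub>2. distinct [x\<^sub>1, y\<^sub>1, x\<^sub>2, y\<^sub>2] \<longrightarrow>
        derives_all L
          (inst2 x y \<Delta> (Var x\<^sub>1) (Var y\<^sub>1) \<union> inst2 x y \<Delta> (Var x\<^sub>2) (Var y\<^sub>2))
          (inst2 x y \<Delta> (c (Var x\<^sub>1) (Var x\<^sub>2)) (c (Var y\<^sub>1) (Var y\<^sub>2))))"

definition finitely_equivalential :: "('p fm set \<Rightarrow> 'p fm \<Rightarrow> bool) \<Rightarrow> bool" where
  "finitely_equivalential L \<longleftrightarrow> (\<exists>x y \<Delta>. finite \<Delta> \<and> equivalence_formulas L x y \<Delta>)"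

end

theory Submission
  imports Defs
begin

text \<open>
  wBIL is sound for local consequence on Kripke frames. Consider the infinite zigzag
  \<open>0 < 1 > 2 < 3 > \<dots>\<close>. Formulas of bounded size cannot distinguish at the point \<open>0\<close> two
  valuations that agree near \<open>0\<close>, so for finite \<open>\<Delta>\<close> and large \<open>m\<close> the point \<open>0\<close> satisfies
  \<open>\<Delta>(x, y)\<close> when \<open>x\<close> is true everywhere and \<open>y\<close> exactly below \<open>2m\<close>. By (Re) it then satisfies
  \<open>\<Delta>((\<not>\<sim>)\<^sup>k x, (\<not>\<sim>)\<^sup>k y)\<close> for all \<open>k\<close>. Each application of \<open>\<not>\<sim>\<close> shrinks the truth set of \<open>y\<close>
  by two points, hence for \<open>k = m\<close> it is empty, which contradicts (MP').
\<close>

primrec sat :: "('w \<Rightarrow> 'w \<Rightarrow> bool) \<Rightarrow> ('p \<Rightarrow> 'w set) \<Rightarrow> 'w \<Rightarrow> 'p fm \<Rightarrow> bool" where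
  "sat le V w (Var p) \<longleftrightarrow> w \<in> V p"
| "sat le V w \<^bold>\<bottom> \<longleftrightarrow> False"
| "sat le V w \<^bold>\<top> \<longleftrightarrow> True"
| "sat le V w (\<phi> \<^bold>\<and> \<psi>) \<longleftrightarrow> sat le V w \<phi> \<and> sat le V w \<psi>"
| "sat le V w (\<phi> \<^bold>\<or> \<psi>) \<longleftrightarrow> sat le V w \<phi> \<or> sat le V w \<psi>"
| "sat le V w (\<phi> \<^bold>\<rightarrow> \<psi>) \<longleftrightarrow> (\<forall>v. le w v \<longrightarrow> sat le V v \<phi> \<longrightarrow> sat le V v \<psi>)"
| "sat le V w (\<phi> \<^bold>\<prec> \<psi>) \<longleftrightarrow> (\<exists>v. le v w \<and> sat le V v \<phi> \<and> \<not> sat le V v \<psi>)"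

lemma sat_subst: "sat le V w (subst \<sigma> \<phi>) \<longleftrightarrow> sat le (\<lambda>p. {v. sat le V v (\<sigma> p)}) w \<phi>"
  by (induction \<phi> arbitrary: w) auto

lemma sat_cong: "(\<And>p. p \<in> set_fm \<phi> \<Longrightarrow> V p = V' p) \<Longrightarrow> sat le V w \<phi> \<longleftrightarrow> sat le V' w \<phi>"
  by (induction \<phi> arbitrary: w) auto

definition upset :: "('w \<Rightarrow> 'w \<Rightarrow> bool) \<Rightarrow> 'w set \<Rightarrow> bool" where
  "upset le A \<longleftrightarrow> (\<forall>v w. v \<in> A \<longrightarrow> le v w \<longrightarrow> w \<in> A)"

locale kripke_frame =
  fixes le :: "'w \<Rightarrow> 'w \<Rightarrow> bool"
  assumes le_refl: "le w w"
    and le_trans: "le u v \<Longrightarrow> le v w \<Longrightarrow> le u w"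
begin

lemma sat_persistent:
  "(\<And>p. upset le (V p)) \<Longrightarrow> sat le V v \<phi> \<Longrightarrow> le v w \<Longrightarrow> sat le V w \<phi>"
proof (induction \<phi> arbitrary: v w)
  case (Var p)
  then show ?case unfolding upset_def by auto
qed (auto; meson le_trans)+

lemma sat_axiom:
  assumes "bil_axiom \<phi>" and V: "\<And>p. upset le (V p)"
  shows "sat le V w \<phi>"
  using assms(1)
proof cases
  case (A1 \<phi> \<psi>)
  then show ?thesis using sat_persistent[of V, OF V] by auto
next
  case (A2 \<phi> \<psi> \<chi>)
  then show ?thesis using le_refl le_trans by simp blast
next
  case (A5 \<phi> \<chi> \<psi>)
  then show ?thesis using le_trans by simp
next
  case (A8 \<chi> \<phi> \<psi>)
  then show ?thesis using le_trans by simp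
next
  case (A11 \<phi> \<psi>)
  then show ?thesis using le_refl by auto
next
  case (A12 \<phi> \<psi>)
  then show ?thesis using le_refl by auto
next
  case (A13 \<phi> \<psi> \<chi>)
  have "sat le V v (\<phi> \<^bold>\<prec> (\<psi> \<^bold>\<or> \<chi>))" if v: "sat le V v ((\<phi> \<^bold>\<prec> \<psi>) \<^bold>\<prec> \<chi>)" for v
  proof -
    from v obtain t u where tu: "le t v" "le u t" "sat le V u \<phi>" "\<not> sat le V u \<psi>" "\<not> sat le V t \<chi>"
      by auto
    \<comment> \<open>Persistence read backwards: since \<open>u\<close> lies below
      \<open>t\<close>, truth of \<chi> at \<open>u\<close> would carry over to
      \<open>t\<close>.\<close>
    then have "\<not> sat le V u \<chi>" using sat_persistent[of V, OF V] by blast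
    moreover have "le u v" using tu le_trans by blast
    ultimately show ?thesis using tu by auto
  qed
  then show ?thesis using A13 by simp
next
  case (A14 \<phi> \<psi>)
  then show ?thesis using le_refl by auto
qed auto

text \<open>The consequence is local: premises are assumed at the single point \<open>w\<close>. The
  premise of \<open>wDN\<close> has no hypotheses, so the induction over arbitrary \<open>w\<close>
  makes its formula true at all points, and its weak negation then fails everywhere.\<close>

lemma wBIL_sound:
  assumes "\<Gamma> \<turnstile>\<^sub>w \<phi>" and V: "\<And>p. upset le (V p)" and "\<And>\<gamma>. \<gamma> \<in> \<Gamma> \<Longrightarrow> sat le V w \<gamma>"
  shows "sat le V w \<phi>"
  using assms(1,3)
proof (induction arbitrary: w)
  case (Ax \<phi> \<Gamma>)
  then show ?case using V by (simp add: sat_axiom)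
next
  case (MP \<Gamma> \<phi> \<psi>)
  then have "sat le V w \<phi>" "sat le V w (\<phi> \<^bold>\<rightarrow> \<psi>)" by blast+
  then show ?case using le_refl by auto
qed auto

end

text \<open>This is \<Delta>(A, B) as a relation between truth sets at \<open>w\<close>. Sending
  every variable other than \<open>x\<close> to \<open>B\<close> keeps the valuation persistent
  whenever \<open>A\<close> and \<open>B\<close> are upsets.\<close>

definition sat_all2 ::
  "('w \<Rightarrow> 'w \<Rightarrow> bool) \<Rightarrow> 'p \<Rightarrow> 'p fm set \<Rightarrow> 'w \<Rightarrow> 'w set \<Rightarrow> 'w set \<Rightarrow> bool" where
  "sat_all2 le x \<Delta> w A B \<longleftrightarrow> (\<forall>\<delta>\<in>\<Delta>. sat le (\<lambda>p. if p = x then A else B) w \<delta>)"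

lemma sat_inst2:
  assumes "x \<noteq> y" and "\<forall>\<delta>\<in>\<Delta>. set_fm \<delta> \<subseteq> {x, y}"
  shows "(\<forall>\<theta>\<in>inst2 x y \<Delta> \<phi> \<psi>. sat le V w \<theta>) \<longleftrightarrow>
    sat_all2 le x \<Delta> w {v. sat le V v \<phi>} {v. sat le V v \<psi>}"
proof -
  have "sat le V w (subst (Var(x := \<phi>, y := \<psi>)) \<delta>) \<longleftrightarrow>
      sat le (\<lambda>p. if p = x then {v. sat le V v \<phi>} else {v. sat le V v \<psi>}) w \<delta>"
    if "\<delta> \<in> \<Delta>" for \<delta>
    unfolding sat_subst using assms that by (intro sat_cong) auto
  then show ?thesis by (simp add: inst2_def sat_all2_def)
qed

locale equivalential_frame = kripke_frame le
  for le :: "'w \<Rightarrow> 'w \<Rightarrow> bool" +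
  fixes x y :: 'p and \<Delta> :: "'p fm set"
  assumes equiv: "equivalence_formulas wBIL x y \<Delta>"
    and infinite_vars: "infinite (UNIV :: 'p set)"
begin

lemma distinct_xy: "x \<noteq> y"
  and vars_subset: "\<forall>\<delta>\<in>\<Delta>. set_fm \<delta> \<subseteq> {x, y}"
  using equiv by (auto simp: equivalence_formulas_def)

lemmas sat_inst2_iff = sat_inst2[OF distinct_xy vars_subset]

lemma sat_all2_refl:
  assumes "upset le A"
  shows "sat_all2 le x \<Delta> w A A"
proof -
  have "{} \<turnstile>\<^sub>w \<theta>" if "\<theta> \<in> inst2 x y \<Delta> (Var x) (Var x)" for \<theta>
    using equiv that by (auto simp: equivalence_formulas_def derives_all_def)
  then have "\<forall>\<theta>\<in>inst2 x y \<Delta> (Var x) (Var x). sat le (\<lambda>_. A) w \<theta>"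
    using assms by (auto intro: wBIL_sound[of "{}"])
  then show ?thesis by (simp add: sat_inst2_iff)
qed

lemma sat_all2_mp:
  assumes "upset le A" "upset le B" and "sat_all2 le x \<Delta> w A B" and "w \<in> A"
  shows "w \<in> B"
proof -
  let ?V = "\<lambda>p. if p = x then A else B"
  have "insert (Var x) (inst2 x y \<Delta> (Var x) (Var y)) \<turnstile>\<^sub>w Var y"
    using equiv by (simp add: equivalence_formulas_def)
  then have "sat le ?V w (Var y)"
  proof (rule wBIL_sound)
    have "\<forall>\<theta>\<in>inst2 x y \<Delta> (Var x) (Var y). sat le ?V w \<theta>"
      using assms(3) distinct_xy by (simp add: sat_inst2_iff)
    then show "sat le ?V w \<gamma>" if "\<gamma> \<in> insert (Var x) (inst2 x y \<Delta> (Var x) (Var y))" for \<gamma>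
      using that assms(4) by auto
  qed (use assms in auto)
  then show ?thesis using distinct_xy by simp
qed

text \<open>Semantic form of (Re): \<open>f\<close> is the operation on truth sets induced by
  \<open>c\<close>, and the four upsets are named by distinct variables, which exist because the
  type of variables is infinite.\<close>

lemma sat_all2_binary:
  fixes c :: "'p fm \<Rightarrow> 'p fm \<Rightarrow> 'p fm"
  assumes c: "c \<in> {And, Or, Imp, Excl}"
    and f: "\<And>V v \<phi> \<psi>. sat le V v (c \<phi> \<psi>) \<longleftrightarrow> v \<in> f {u. sat le V u \<phi>} {u. sat le V u \<psi>}"
    and up: "upset le A" "upset le B" "upset le C" "upset le D"
    and AB: "sat_all2 le x \<Delta> w A B" and CD: "sat_all2 le x \<Delta> w C D"
  shows "sat_all2 le x \<Delta> w (f A C) (f B D)"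
proof -
  have fresh: "\<exists>p. p \<notin> X" if "finite X" for X :: "'p set"
    using ex_new_if_finite[OF infinite_vars that] .
  obtain x1 y1 x2 y2 :: 'p
    where "y1 \<notin> {x1}" "x2 \<notin> {x1, y1}" "y2 \<notin> {x1, y1, x2}"
    using fresh by (meson finite.intros)
  then have d: "distinct [x1, y1, x2, y2]" by auto
  let ?V = "\<lambda>p. if p = x1 then A else if p = y1 then B else if p = x2 then C else D"
  let ?\<Gamma> = "inst2 x y \<Delta> (Var x1) (Var y1) \<union> inst2 x y \<Delta> (Var x2) (Var y2)"
  have "\<forall>\<theta>\<in>inst2 x y \<Delta> (Var x1) (Var y1). sat le ?V w \<theta>"
    "\<forall>\<theta>\<in>inst2 x y \<Delta> (Var x2) (Var y2). sat le ?V w \<theta>"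
    using AB CD d by (auto simp: sat_inst2_iff)
  then have \<Gamma>: "sat le ?V w \<gamma>" if "\<gamma> \<in> ?\<Gamma>" for \<gamma>
    using that by blast
  have "?\<Gamma> \<turnstile>\<^sub>w \<theta>" if "\<theta> \<in> inst2 x y \<Delta> (c (Var x1) (Var x2)) (c (Var y1) (Var y2))" for \<theta>
    using equiv c d that unfolding equivalence_formulas_def derives_all_def by blast
  then have "\<forall>\<theta>\<in>inst2 x y \<Delta> (c (Var x1) (Var x2)) (c (Var y1) (Var y2)). sat le ?V w \<theta>"
    using wBIL_sound[of ?\<Gamma> _ ?V, OF _ _ \<Gamma>] up by simp
  then show ?thesis using d by (auto simp: sat_inst2_iff f split: if_splits)
qed

end

text \<open>The operator on truth sets induced by \<open>\<not>\<sim>\<close>.\<close>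

definition box :: "('w \<Rightarrow> 'w \<Rightarrow> bool) \<Rightarrow> 'w set \<Rightarrow> 'w set" where
  "box le A = {w. \<forall>v. le w v \<longrightarrow> (\<forall>u. le u v \<longrightarrow> u \<in> A)}"

text \<open>Two uses of (Re), first for exclusion from truth and then for implication into falsity.
  The constant arguments \<open>UNIV\<close> and \<open>{}\<close> are related to themselves by
  reflexivity.\<close>

lemma (in equivalential_frame) sat_all2_box:
  assumes up: "upset le A" "upset le B" and AB: "sat_all2 le x \<Delta> w A B"
  shows "sat_all2 le x \<Delta> w (box le A) (box le B)"
proof -
  let ?excl = "\<lambda>A B. {w. \<exists>v. le v w \<and> v \<in> A \<and> v \<notin> B}"
  let ?imp = "\<lambda>A B. {w. \<forall>v. le w v \<longrightarrow> v \<in> A \<longrightarrow> v \<in> B}"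
  have UNIV: "upset le UNIV" and empty: "upset le {}" by (simp_all add: upset_def)
  have up_excl: "upset le (?excl A B)" for A B
    unfolding upset_def using le_trans by blast
  have "sat_all2 le x \<Delta> w (?excl UNIV A) (?excl UNIV B)"
    by (rule sat_all2_binary[of Excl ?excl])
      (use up AB UNIV sat_all2_refl[OF UNIV] in auto)
  then have "sat_all2 le x \<Delta> w (?imp (?excl UNIV A) {}) (?imp (?excl UNIV B) {})"
    by (intro sat_all2_binary[of Imp ?imp])
      (use up_excl[of UNIV] empty sat_all2_refl[OF empty] in auto)
  moreover have "box le A = ?imp (?excl UNIV A) {}" for A
    by (auto simp: box_def)
  ultimately show ?thesis by simp
qed

text \<open>Odd points are maximal and even points minimal, so no two strict steps compose and
  transitivity holds.\<close>

definition zigzag :: "nat \<Rightarrow> nat \<Rightarrow> bool" where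
  "zigzag u v \<longleftrightarrow> u = v \<or> even u \<and> (v = Suc u \<or> u = Suc v)"

interpretation zigzag: kripke_frame zigzag
  by standard (auto simp: zigzag_def)

text \<open>Implication and exclusion move by at most one point, and each binary connective adds one
  to \<open>size\<close>. Evaluation at \<open>v\<close> therefore never leaves the points below
  \<open>n\<close>.\<close>

lemma sat_zigzag_local:
  assumes "\<And>p v. v < n \<Longrightarrow> v \<in> V p \<longleftrightarrow> v \<in> V' p"
  shows "v + size \<phi> < n \<Longrightarrow> sat zigzag V v \<phi> \<longleftrightarrow> sat zigzag V' v \<phi>"
proof (induction \<phi> arbitrary: v)
  case (Imp \<phi> \<psi>)
  have "sat zigzag V u \<phi> \<longleftrightarrow> sat zigzag V' u \<phi>" "sat zigzag V u \<psi> \<longleftrightarrow> sat zigzag V' u \<psi>"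
    if "zigzag v u" for u
    using that Imp.prems by (auto simp: zigzag_def intro!: Imp.IH)
  then show ?case by auto
next
  case (Excl \<phi> \<psi>)
  have "sat zigzag V u \<phi> \<longleftrightarrow> sat zigzag V' u \<phi>" "sat zigzag V u \<psi> \<longleftrightarrow> sat zigzag V' u \<psi>"
    if "zigzag u v" for u
    using that Excl.prems by (auto simp: zigzag_def intro!: Excl.IH)
  then show ?case by auto
qed (use assms in auto)

text \<open>The even bound matters: a nonempty such segment ends in an odd point, which is
  maximal.\<close>

lemma upset_zigzag_lessThan: "upset zigzag {..<2 * m}"
  unfolding upset_def zigzag_def by auto

lemma box_zigzag_lessThan: "box zigzag {..<2 * Suc m} = {..<2 * m}"
proof (intro set_eqI iffI)
  fix w
  assume w: "w \<in> box zigzag {..<2 * Suc m}"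
  \<comment> \<open>Here \<open>v\<close> is the odd point at or just above \<open>w\<close>;
    stepping down from it to the right reaches \<open>Suc v\<close>, the farthest point that
    \<open>box\<close> inspects. Parity settles the case of odd \<open>w\<close>.\<close>
  define v where "v = (if even w then Suc w else w)"
  have "zigzag w v" "zigzag (Suc v) v" by (auto simp: v_def zigzag_def)
  with w have "Suc v < 2 * Suc m" unfolding box_def by blast
  then show "w \<in> {..<2 * m}" unfolding v_def lessThan_iff by presburger
next
  fix w
  assume "w \<in> {..<2 * m}"
  then show "w \<in> box zigzag {..<2 * Suc m}"
    by (auto simp: box_def zigzag_def)
qed

theorem mainTheorem6:
  assumes "countable (UNIV :: 'p set)" and "infinite (UNIV :: 'p set)"
  shows "\<not> finitely_equivalential (wBIL :: 'p fm set \<Rightarrow> 'p fm \<Rightarrow> bool)"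
proof
  assume "finitely_equivalential (wBIL :: 'p fm set \<Rightarrow> 'p fm \<Rightarrow> bool)"
  then obtain x y :: 'p and \<Delta> where fin: "finite \<Delta>" and "equivalence_formulas wBIL x y \<Delta>"
    unfolding finitely_equivalential_def by blast
  then interpret equivalential_frame zigzag x y \<Delta>
    using assms(2) by unfold_locales
  have UNIV: "upset zigzag UNIV" by (simp add: upset_def)
  obtain m where m: "\<forall>\<delta>\<in>\<Delta>. size \<delta> < m"
    using finite_nat_set_iff_bounded[of "size ` \<Delta>"] fin by auto
  have "sat_all2 zigzag x \<Delta> 0 UNIV {..<2 * m}"
    unfolding sat_all2_def
  proof
    fix \<delta> assume "\<delta> \<in> \<Delta>"
    then have "sat zigzag (\<lambda>_. UNIV) 0 \<delta>"
      using sat_all2_refl[OF UNIV] by (simp add: sat_all2_def)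
    \<comment> \<open>Evaluation of \<delta> at 0 stays below \<open>2 * m\<close>, where the two
      valuations agree.\<close>
    moreover have "0 + size \<delta> < 2 * m" using m \<open>\<delta> \<in> \<Delta>\<close> by auto
    ultimately show "sat zigzag (\<lambda>p. if p = x then UNIV else {..<2 * m}) 0 \<delta>"
      by (subst (asm) sat_zigzag_local[where V' = "\<lambda>p. if p = x then UNIV else {..<2 * m}"])
        auto
  qed
  then have "sat_all2 zigzag x \<Delta> 0 UNIV {..<2 * 0}"
  \<comment> \<open>The induction counts down: each \<open>box\<close> lowers the bound by two and
    fixes \<open>UNIV\<close>, until the second set is empty while 0 still lies in the
    first.\<close>
  proof (induction m)
    case (Suc m)
    have "box zigzag UNIV = UNIV" by (simp add: box_def)
    then show ?case
      using Suc sat_all2_box[OF UNIV upset_zigzag_lessThan Suc.prems] box_zigzag_lessThan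
      by simp
  qed
  from sat_all2_mp[OF UNIV upset_zigzag_lessThan this] show False by simp
qed

end
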